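(* Let $n,k\ge1$ be integers. For every real number $q>0$, each of the following polynomials in $x$ has all roots real: $$G_{n,k}^{\mathrm{finv}}(x,q)=\sum_{\pi^\xi\in\mathbb{Z}_k\wr\mathfrak{S}_n}x^{\operatorname{des}\pi^\xi}q^{\operatorname{finv}\pi^\xi},\quad G_{n,k}^{\mathrm{comaj}}(x,q)=\sum_{\pi^\xi\in\mathbb{Z}_k\wr\mathfrak{S}_n}x^{\operatorname{des}\pi^\xi}q^{\operatorname{comaj}\pi^\xi},\quad G_{n,k}^{\mathrm{maj}}(x,q)=\sum_{\pi^\xi\in\mathbb{Z}_k\wr\mathfrak{S}_n}x^{\operatorname{des}\pi^\xi}q^{\operatorname{maj}\pi^\xi}.$$
   Context: $\mathbb{Z}_k\wr\mathfrak{S}_n$ is regarded as the set of $k$-colored permutations, i.e. pairs $\pi^\xi=(\pi,\xi)$ with $\pi=(\pi_1,\dots,\pi_n)$ a permutation of $\{1,\dots,n\}$ and $\xi=(\xi_1,\dots,\xi_n)\in\{0,1,\dots,k-1\}^n$. With the convention $\pi_0=\xi_0=0$, the descent set is $\operatorname{Des}\pi^\xi=\{i\in\{0,\dots,n-1\}\mid \xi_i<\xi_{i+1},\text{ or }\xi_i=\xi_{i+1}\text{ and }\pi_i>\pi_{i+1}\}$, and $\operatorname{des}\pi^\xi=|\operatorname{Des}\pi^\xi|$, $\operatorname{maj}\pi^\xi=\sum_{j\in\operatorname{Des}\pi^\xi}j$, $\operatorname{comaj}\pi^\xi=\sum_{j\in\operatorname{Des}\pi^\xi}(n-j)$. The flag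 inversion number is $\operatorname{finv}\pi^\xi=\operatorname{inv}\pi+\sum_{i=1}^n i\,\xi_i$, where $\operatorname{inv}\pi=|\{(i,j)\mid1\le i<j\le n,\ \pi_i>\pi_j\}|$. *)

theory Defs
  imports
    Complex_Main
    "HOL-Combinatorics.Permutations"
    "HOL-Computational_Algebra.Polynomial"
begin

(* A colored permutation is a pair (\<pi>, \<xi>) of functions on nat, used on {1..n}. Both components
   are extended outside {1..n} in a canonical way (\<pi> by the identity, \<xi> by 0), so that the pairs
   correspond bijectively to the colored permutations and the convention \<pi> 0 = \<xi> 0 = 0 holds
   automatically. *)

type_synonym colored_perm = "(nat \<Rightarrow> nat) \<times> (nat \<Rightarrow> nat)"

definition colored_perms :: "nat \<Rightarrow> nat \<Rightarrow> colored_perm set" where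
  "colored_perms k n =
     {(\<pi>, \<xi>). \<pi> permutes {1..n} \<and> (\<forall>i\<in>{1..n}. \<xi> i \<in> {0..<k}) \<and> (\<forall>i. i \<notin> {1..n} \<longrightarrow> \<xi> i = 0)}"

definition Des :: "nat \<Rightarrow> colored_perm \<Rightarrow> nat set" where
  "Des n = (\<lambda>(\<pi>, \<xi>).
     {i \<in> {0..<n}. \<xi> i < \<xi> (i + 1) \<or> \<xi> i = \<xi> (i + 1) \<and> \<pi> i > \<pi> (i + 1)})"

definition des :: "nat \<Rightarrow> colored_perm \<Rightarrow> nat" where
  "des n w = card (Des n w)"

definition maj :: "nat \<Rightarrow> colored_perm \<Rightarrow> nat" where
  "maj n w = (\<Sum>j\<in>Des n w. j)"

definition comaj :: "nat \<Rightarrow> colored_perm \<Rightarrow> nat" where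
  "comaj n w = (\<Sum>j\<in>Des n w. n - j)"

definition inv_num :: "nat \<Rightarrow> (nat \<Rightarrow> nat) \<Rightarrow> nat" where
  "inv_num n \<pi> = card {(i, j). 1 \<le> i \<and> i < j \<and> j \<le> n \<and> \<pi> i > \<pi> j}"

definition finv :: "nat \<Rightarrow> colored_perm \<Rightarrow> nat" where
  "finv n = (\<lambda>(\<pi>, \<xi>). inv_num n \<pi> + (\<Sum>i = 1..n. i * \<xi> i))"

definition G_finv :: "nat \<Rightarrow> nat \<Rightarrow> real \<Rightarrow> real poly" where
  "G_finv n k q = (\<Sum>w\<in>colored_perms k n. monom (q ^ finv n w) (des n w))"

definition G_comaj :: "nat \<Rightarrow> nat \<Rightarrow> real \<Rightarrow> real poly" where
  "G_comaj n k q = (\<Sum>w\<in>colored_perms k n. monom (q ^ comaj n w) (des n w))"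

definition G_maj :: "nat \<Rightarrow> nat \<Rightarrow> real \<Rightarrow> real poly" where
  "G_maj n k q = (\<Sum>w\<in>colored_perms k n. monom (q ^ maj n w) (des n w))"

(* For nonzero p; nonzero constants have no roots and qualify, while the zero polynomial does not.
   The polynomials above are nonzero for n, k \<ge> 1 and q > 0, so this is not a restriction. *)
definition all_roots_real :: "real poly \<Rightarrow> bool" where
  "all_roots_real p \<longleftrightarrow> (\<forall>z::complex. poly (map_poly complex_of_real p) z = 0 \<longrightarrow> z \<in> \<real>)"

end

theory Submission
  imports Defs
begin

text \<open>
  Weight colored permutations jointly by \<open>p ^ comaj * q ^ finv\<close> and refine the generating polynomial
  by the rank of the last letter (\<open>last_rank\<close>). Appending a letter of rank \<open>r\<close> creates a descent
  exactly if the previous last letter has rank below a threshold \<open>t r\<close> monotone in \<open>r\<close>, so the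
  refined polynomials satisfy
  \<open>F (n + 1) r x = q ^ r * (\<Sum>h. (if h < t r then p * x else 1) * F n h (p * x))\<close>.
  For \<open>x\<close> in the open upper half plane, such a recursion preserves the property that the values
  \<open>F n 0 x, F n 1 x, \<dots>, x * F n 0 x\<close> appear in counterclockwise order inside an angle less than
  \<open>\<pi>\<close>; hence their sum does not vanish there. The polynomial for \<open>maj\<close> reduces to the one for \<open>comaj\<close>
  by \<open>maj + comaj = n * des\<close>.
\<close>

section \<open>Sequences in angular order\<close>

text \<open>For nonzero \<open>u\<close> and \<open>v\<close>, \<open>Im (cnj u * v) \<ge> 0\<close>
  places \<open>v\<close> at an angle from 0 to \<pi> counterclockwise from \<open>u\<close>. The
  second inequality wraps the order around through \<open>z\<close>. Weak inequalities admit zero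
  entries, so finite families can be padded with 0.\<close>

definition fan :: "complex \<Rightarrow> (nat \<Rightarrow> complex) \<Rightarrow> bool" where
  "fan z a \<longleftrightarrow> (\<forall>i j. i \<le> j \<longrightarrow> Im (cnj (a i) * a j) \<ge> 0 \<and> Im (cnj (a j) * (z * a i)) \<ge> 0)"

lemma Im_cnj_scale: "Im (cnj (z * u) * (z * v)) = (cmod z)\<^sup>2 * Im (cnj u * v)"
  unfolding cmod_power2 by (simp add: algebra_simps power2_eq_square)

lemma Im_cnj_mult_self: "Im (cnj u * (z * u)) = (cmod u)\<^sup>2 * Im z"
  unfolding cmod_power2 by (simp add: algebra_simps power2_eq_square)

lemma Im_cnj_sum_nonneg:
  assumes "\<And>i j. i \<in> I \<Longrightarrow> j \<in> J \<Longrightarrow> Im (cnj (f i) * g j) \<ge> 0"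
  shows "Im (cnj (\<Sum>i\<in>I. f i) * (\<Sum>j\<in>J. g j)) \<ge> 0"
proof -
  have "cnj (\<Sum>i\<in>I. f i) * (\<Sum>j\<in>J. g j) = (\<Sum>i\<in>I. \<Sum>j\<in>J. cnj (f i) * g j)"
    by (simp only: cnj_sum sum_product)
  then show ?thesis
    using assms by (simp add: sum_nonneg del: complex_cnj_mult times_complex.sel)
qed

text \<open>
  The pairing \<open>Im (cnj u * v)\<close> is real bilinear and alternating. Two of the new values have the form
  \<open>D + B\<close> and \<open>D + z * B\<close>, where \<open>B\<close> collects the indices between the two thresholds, so both
  inequalities reduce to the pairings of \<open>B\<close> with \<open>D\<close> and of \<open>D\<close> with \<open>z * B\<close>.
\<close>

lemma fan_step:
  assumes z: "Im z > 0" and a: "fan z a" and t: "mono t" and c: "\<And>r. c r \<ge> 0"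
  shows "fan z (\<lambda>r. of_real (c r) * (\<Sum>h\<le>N. (if h < t r then z else 1) * a h))"
  unfolding fan_def
proof (intro allI impI)
  fix r s :: nat
  assume "r \<le> s"
  with t have trs: "t r \<le> t s" by (simp add: monoD)
  \<comment> \<open>These are the indices that carry the factor \<open>z\<close> in both sums, only
    in the sum for \<open>s\<close>, and in neither.\<close>
  define I1 I2 I3 where "I1 = {h. h \<le> N \<and> h < t r}" and "I2 = {h. h \<le> N \<and> t r \<le> h \<and> h < t s}"
    and "I3 = {h. h \<le> N \<and> t s \<le> h}"
  note I_defs = I1_def I2_def I3_def
  define A B C where "A = sum a I1" and "B = sum a I2" and "C = sum a I3"
  note ABC_defs = A_def B_def C_def
  define D where "D = z * A + C"
  have fin: "finite I1" "finite I2" "finite I3" by (auto simp: I_defs)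
  have split: "{..N} = I1 \<union> (I2 \<union> I3)" "I1 \<inter> (I2 \<union> I3) = {}" "I2 \<inter> I3 = {}"
    using trs by (auto simp: I_defs)
  have split_sum: "sum g {..N} = sum g I1 + (sum g I2 + sum g I3)" for g :: "nat \<Rightarrow> complex"
    unfolding split(1) using fin split by (simp add: sum.union_disjoint)
  have br: "(\<Sum>h\<le>N. (if h < t r then z else 1) * a h) = D + B"
    unfolding split_sum using trs
    by (simp add: D_def ABC_defs I_defs sum_distrib_left)
  have bs: "(\<Sum>h\<le>N. (if h < t s then z else 1) * a h) = D + z * B"
  proof -
    have "(\<Sum>h\<in>I1. (if h < t s then z else 1) * a h) = z * A"
      unfolding A_def sum_distrib_left by (rule sum.cong) (use trs in \<open>auto simp: I_defs\<close>)
    moreover have "(\<Sum>h\<in>I2. (if h < t s then z else 1) * a h) = z * B"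
      unfolding B_def sum_distrib_left by (rule sum.cong) (use trs in \<open>auto simp: I_defs\<close>)
    moreover have "(\<Sum>h\<in>I3. (if h < t s then z else 1) * a h) = C"
      unfolding C_def by (rule sum.cong) (use trs in \<open>auto simp: I_defs\<close>)
    ultimately show ?thesis unfolding split_sum D_def by simp
  qed
  have fwd: "Im (cnj (a i) * a j) \<ge> 0" and bwd: "Im (cnj (a j) * (z * a i)) \<ge> 0" if "i \<le> j" for i j
    using a that by (auto simp: fan_def)
  have AB: "Im (cnj A * B) \<ge> 0" and BC: "Im (cnj B * C) \<ge> 0"
    unfolding ABC_defs by (rule Im_cnj_sum_nonneg, rule fwd, force simp: I_defs)+
  have BzA: "Im (cnj B * (z * A)) \<ge> 0" and CzB: "Im (cnj C * (z * B)) \<ge> 0"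
    unfolding ABC_defs sum_distrib_left[of z]
    by (rule Im_cnj_sum_nonneg, rule bwd, use trs in \<open>force simp: I_defs\<close>)+
  \<comment> \<open>Indices in \<open>I1\<close> precede those in \<open>I2\<close>, and indices in
    \<open>I3\<close> follow them: so \<open>A\<close> enters through the wrap-around inequality and
    \<open>C\<close> through the plain one. For \<open>DzB\<close> the roles are swapped.\<close>
  have BD: "Im (cnj B * D) \<ge> 0"
    using BzA BC unfolding D_def distrib_left plus_complex.sel by linarith
  have "Im (cnj (z * A) * (z * B)) \<ge> 0"
    unfolding Im_cnj_scale using AB by simp
  then have DzB: "Im (cnj D * (z * B)) \<ge> 0"
    using CzB unfolding D_def complex_cnj_add distrib_right plus_complex.sel by linarith
  have self: "Im (cnj u * (z * u)) \<ge> 0" for u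
    unfolding Im_cnj_mult_self using z by simp
  \<comment> \<open>In both expansions a vector paired with itself gives 0, and \<open>u\<close>
    paired with \<open>z * u\<close> gives a nonnegative value.\<close>
  have "cnj (D + B) * (D + z * B) = cnj D * D + cnj D * (z * B) + cnj B * D + cnj B * (z * B)"
    by (simp add: algebra_simps)
  moreover have "Im (cnj D * D) = 0" by (simp add: algebra_simps)
  ultimately have 1: "Im (cnj (D + B) * (D + z * B)) \<ge> 0"
    using DzB BD self[of B] by (simp only: plus_complex.sel)
  have "cnj (D + z * B) * (z * (D + B))
      = cnj D * (z * D) + cnj D * (z * B) + cnj (z * B) * (z * D) + cnj (z * B) * (z * B)"
    by (simp add: algebra_simps)
  moreover have "Im (cnj (z * B) * (z * B)) = 0" by (simp add: algebra_simps)
  moreover have "Im (cnj (z * B) * (z * D)) \<ge> 0"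
    unfolding Im_cnj_scale using BD by simp
  ultimately have 2: "Im (cnj (D + z * B) * (z * (D + B))) \<ge> 0"
    using DzB self[of D] by (simp only: plus_complex.sel)
  have scale: "cnj (of_real x * u) * (of_real y * v) = of_real (x * y) * (cnj u * v)"
    "cnj (of_real x * u) * (z * (of_real y * v)) = of_real (x * y) * (cnj u * (z * v))" for x y u v
    by simp_all
  have Im_scale: "Im (of_real x * u) = x * Im u" for x u by simp
  show "Im (cnj (of_real (c r) * (\<Sum>h\<le>N. (if h < t r then z else 1) * a h)) *
         (of_real (c s) * (\<Sum>h\<le>N. (if h < t s then z else 1) * a h))) \<ge> 0 \<and>
        Im (cnj (of_real (c s) * (\<Sum>h\<le>N. (if h < t s then z else 1) * a h)) *
         (z * (of_real (c r) * (\<Sum>h\<le>N. (if h < t r then z else 1) * a h)))) \<ge> 0"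
    unfolding br bs scale Im_scale using 1 2 c by (simp only: mult_nonneg_nonneg)
qed

text \<open>Paired with the extreme value \<open>a 0\<close>, all entries contribute nonnegatively.
  A zero sum would put them on the line through \<open>a 0\<close>, and the wrap-around inequality
  on the same ray, where \<open>a 0\<close> cannot be cancelled.\<close>

lemma fan_sum_nonzero:
  assumes z: "Im z > 0" and a: "fan z a" and a0: "a 0 \<noteq> 0"
  shows "(\<Sum>h\<le>N. a h) \<noteq> 0"
proof
  assume S: "(\<Sum>h\<le>N. a h) = 0"
  \<comment> \<open>Then every \<open>a h\<close> is a nonnegative real multiple of \<open>a 0\<close>.\<close>
  have "(\<Sum>h\<le>N. Im (cnj (a 0) * a h)) = Im (cnj (a 0) * (\<Sum>h\<le>N. a h))"
    unfolding sum_distrib_left Im_sum ..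
  with S have "(\<Sum>h\<le>N. Im (cnj (a 0) * a h)) = 0" by simp
  moreover have "Im (cnj (a 0) * a h) \<ge> 0" for h using a unfolding fan_def by blast
  ultimately have Im0: "Im (cnj (a 0) * a h) = 0" if "h \<le> N" for h
    using that by (subst (asm) sum_nonneg_eq_0_iff) auto
  have Re: "Re (cnj (a 0) * a h) \<ge> 0" if "h \<le> N" for h
  proof -
    \<comment> \<open>Since \<open>cnj (a 0) * a h\<close> is real, this inequality only concerns
      its sign.\<close>
    have "0 \<le> Im (cnj (a h) * (z * a 0))" using a unfolding fan_def by blast
    also have "cnj (a h) * (z * a 0) = z * cnj (cnj (a 0) * a h)" by simp
    also have "Im \<dots> = Im z * Re (cnj (a 0) * a h)"
      using Im0[OF that] by (simp del: complex_cnj_mult add: times_complex.sel(2)[of z])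
    finally show ?thesis using z by (simp add: zero_le_mult_iff)
  qed
  have "0 < Re (cnj (a 0) * a 0)" using a0
    by (metis complex_norm_square mult.commute Re_complex_of_real zero_less_norm_iff zero_less_power of_real_power)
  also have "\<dots> \<le> (\<Sum>h\<le>N. Re (cnj (a 0) * a h))"
    using member_le_sum[of 0 "{..N}" "\<lambda>h. Re (cnj (a 0) * a h)"] Re by auto
  also have "\<dots> = Re (cnj (a 0) * (\<Sum>h\<le>N. a h))"
    unfolding sum_distrib_left Re_sum ..
  finally show False using S by simp
qed

section \<open>Appending a last letter of given rank\<close>

text \<open>The cycle \<open>p\<close>, \<open>p + 1\<close>, ..., \<open>n + 1\<close>: composed
  after a permutation of \<open>{1..n}\<close>, it lifts the values from \<open>p\<close> on and
  makes \<open>p\<close> the last letter.\<close>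

definition insert_cycle :: "nat \<Rightarrow> nat \<Rightarrow> nat \<Rightarrow> nat" where
  "insert_cycle n p x = (if x = n + 1 then p else if p \<le> x \<and> x \<le> n then x + 1 else x)"

lemma insert_cycle_permutes:
  assumes "p \<in> {1..n + 1}"
  shows "insert_cycle n p permutes {1..n + 1}"
proof (rule bij_imp_permutes)
  have "inj_on (insert_cycle n p) {1..n + 1}"
    using assms by (auto simp: inj_on_def insert_cycle_def split: if_splits)
  moreover have "insert_cycle n p ` {1..n + 1} \<subseteq> {1..n + 1}"
    using assms by (auto simp: insert_cycle_def)
  ultimately show "bij_betw (insert_cycle n p) {1..n + 1} {1..n + 1}"
    by (simp add: bij_betw_def endo_inj_surj)
qed (use assms in \<open>auto simp: insert_cycle_def\<close>)

lemma insert_cycle_less_iff: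
  "x \<le> n \<Longrightarrow> y \<le> n \<Longrightarrow> insert_cycle n p x < insert_cycle n p y \<longleftrightarrow> x < y"
  by (auto simp: insert_cycle_def)

lemma less_insert_cycle_iff: "x \<le> n \<Longrightarrow> p < insert_cycle n p x \<longleftrightarrow> p \<le> x"
  by (auto simp: insert_cycle_def)

text \<open>
  Position of the last letter in the order (color ascending, then value descending), for which
  descents of a colored permutation become ascents. The ranks are \<open>0, \<dots>, k * n - 1\<close> if \<open>n \<ge> 1\<close>;
  for \<open>n = 0\<close> the rank is \<open>0\<close>, which accounts for the convention \<open>\<pi> 0 = \<xi> 0 = 0\<close>.
\<close>

definition last_rank :: "nat \<Rightarrow> colored_perm \<Rightarrow> nat" where
  "last_rank n = (\<lambda>(\<pi>, \<xi>). \<xi> n * n + (n - \<pi> n))"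

text \<open>Quotient and remainder decode the rank
  \<open>r = color * (n + 1) + (n + 1 - value)\<close>.\<close>

definition append_letter :: "nat \<Rightarrow> nat \<Rightarrow> colored_perm \<Rightarrow> colored_perm" where
  "append_letter n r = (\<lambda>(\<pi>, \<xi>). (insert_cycle n (n + 1 - r mod (n + 1)) \<circ> \<pi>, \<xi>(n + 1 := r div (n + 1))))"

text \<open>For \<open>n \<ge> 1\<close> this counts the ranks of old last letters that form a
  descent with a new letter of rank \<open>r\<close>. For \<open>n = 0\<close> the only old rank is
  0, and the new letter, of color \<open>r\<close>, gives a descent iff
  \<open>r > 0\<close>.\<close>

definition threshold :: "nat \<Rightarrow> nat \<Rightarrow> nat" where
  "threshold n r = (if n = 0 then r else r div (n + 1) * n + r mod (n + 1))"

text \<open>For equal colors the remainders decide; a larger color gains at least \<open>n\<close>,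
  which outweighs any remainder.\<close>

lemma threshold_mono: "mono (threshold n)"
proof (rule monoI)
  fix r s :: nat
  assume rs: "r \<le> s"
  show "threshold n r \<le> threshold n s"
  proof (cases "r div (n + 1) = s div (n + 1)")
    case True
    then have "r mod (n + 1) \<le> s mod (n + 1)"
      using rs by (metis add_le_cancel_left div_mult_mod_eq)
    with True rs show ?thesis by (simp add: threshold_def)
  next
    case False
    then have "r div (n + 1) + 1 \<le> s div (n + 1)"
      using div_le_mono[OF rs, of "n + 1"] by linarith
    then have "(r div (n + 1) + 1) * n \<le> s div (n + 1) * n" by (rule mult_le_mono1)
    moreover have "r mod (n + 1) \<le> n"
      using mod_less_divisor[of "n + 1" r] by linarith
    ultimately have "r div (n + 1) * n + r mod (n + 1) \<le> s div (n + 1) * n"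
      unfolding add_mult_distrib by linarith
    then show ?thesis using rs by (simp add: threshold_def)
  qed
qed

lemma threshold_0 [simp]: "threshold n 0 = 0"
  by (simp add: threshold_def)

lemma colored_perms_permutes: "(\<pi>, \<xi>) \<in> colored_perms k n \<Longrightarrow> \<pi> permutes {1..n}"
  by (simp add: colored_perms_def)

lemma permutes_le: "\<pi> permutes {1..n} \<Longrightarrow> i \<le> n \<Longrightarrow> \<pi> i \<le> (n :: nat)"
  using permutes_in_image[of \<pi> "{1..n}" i] permutes_not_in[of \<pi> "{1..n}" i] by (cases "i = 0") auto

lemma finite_colored_perms: "finite (colored_perms k n)"
proof -
  have "colored_perms k n \<subseteq> {\<pi>. \<pi> permutes {1..n}} \<times>
      {\<xi>. \<forall>i. (i \<in> {1..n} \<longrightarrow> \<xi> i \<in> {0..<k}) \<and> (i \<notin> {1..n} \<longrightarrow> \<xi> i = 0)}"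
    by (auto simp: colored_perms_def)
  then show ?thesis
    by (rule finite_subset)
      (intro finite_cartesian_product finite_permutations finite_set_of_finite_funs; simp)
qed

lemma append_letter_last:
  assumes "(\<pi>, \<xi>) \<in> colored_perms k n"
  shows "fst (append_letter n r (\<pi>, \<xi>)) (n + 1) = n + 1 - r mod (n + 1)"
    and "snd (append_letter n r (\<pi>, \<xi>)) (n + 1) = r div (n + 1)"
  using permutes_not_in[OF colored_perms_permutes[OF assms], of "n + 1"]
  by (simp_all add: append_letter_def insert_cycle_def)

lemma last_rank_append_letter:
  assumes "w \<in> colored_perms k n"
  shows "last_rank (n + 1) (append_letter n r w) = r"
proof -
  obtain \<pi> \<xi> where w: "w = (\<pi>, \<xi>)" by fastforce
  have "r mod (n + 1) \<le> n + 1" by (simp add: less_imp_le)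
  then show ?thesis
    using append_letter_last[OF assms[unfolded w], of r] unfolding w last_rank_def
    by (simp add: case_prod_beta del: mult_Suc_right)
qed

lemma last_rank_less:
  assumes "w \<in> colored_perms k n" "n \<ge> 1"
  shows "last_rank n w < k * n"
proof -
  obtain \<pi> \<xi> where w: "w = (\<pi>, \<xi>)" by fastforce
  have "\<pi> n \<in> {1..n}"
    using assms permutes_in_image[of \<pi> "{1..n}" n] by (simp add: w colored_perms_def)
  moreover have "\<xi> n + 1 \<le> k" using assms by (auto simp: w colored_perms_def Suc_le_eq)
  then have "(\<xi> n + 1) * n \<le> k * n" by (rule mult_le_mono1)
  ultimately show ?thesis by (auto simp: w last_rank_def algebra_simps)
qed

lemma append_letter_bij_betw:
  assumes r: "r < k * (n + 1)"
  shows "bij_betw (append_letter n r) (colored_perms k n) {w \<in> colored_perms k (n + 1). last_rank (n + 1) w = r}"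
proof -
  define p where "p = n + 1 - r mod (n + 1)"
  have rm: "r mod (n + 1) \<le> n" using mod_less_divisor[of "n + 1" r] by linarith
  then have p: "p \<in> {1..n + 1}" unfolding p_def atLeastAtMost_iff by linarith
  note cyc = insert_cycle_permutes[OF p]
  have rd: "r div (n + 1) < k" using r by (simp add: less_mult_imp_div_less del: mult_Suc_right)
  show ?thesis
  proof (rule bij_betw_imageI)
    show "inj_on (append_letter n r) (colored_perms k n)"
    proof (rule inj_onI, clarify)
      fix \<pi> \<xi> \<pi>' \<xi>'
      assume w: "(\<pi>, \<xi>) \<in> colored_perms k n" "(\<pi>', \<xi>') \<in> colored_perms k n"
        and eq: "append_letter n r (\<pi>, \<xi>) = append_letter n r (\<pi>', \<xi>')"
      have "insert_cycle n p \<circ> \<pi> = insert_cycle n p \<circ> \<pi>'"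
        using eq by (simp add: append_letter_def p_def)
      then have "\<pi> = \<pi>'"
        using permutes_inj[OF cyc] by (simp add: fun_eq_iff inj_eq)
      \<comment> \<open>The color at \<open>n + 1\<close> is overwritten, but both original
        functions are 0 there.\<close>
      moreover have "\<xi> i = \<xi>' i" for i
        using eq w by (cases "i = n + 1") (auto simp: append_letter_def colored_perms_def fun_upd_def fun_eq_iff split: if_splits)
      ultimately show "\<pi> = \<pi>' \<and> \<xi> = \<xi>'" by auto
    qed
    show "append_letter n r ` colored_perms k n = {w \<in> colored_perms k (n + 1). last_rank (n + 1) w = r}"
    proof (intro equalityI subsetI)
      fix w assume "w \<in> append_letter n r ` colored_perms k n"
      then obtain v where v: "v \<in> colored_perms k n" and w: "w = append_letter n r v" by blast
      obtain \<pi> \<xi> where v_eq: "v = (\<pi>, \<xi>)" by fastforce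
      have "\<pi> permutes {1..n + 1}"
        using v by (auto simp: v_eq colored_perms_def intro: permutes_subset)
      then have "insert_cycle n p \<circ> \<pi> permutes {1..n + 1}"
        using cyc by (rule permutes_compose)
      then have "w \<in> colored_perms k (n + 1)"
        using v rd unfolding w v_eq p_def by (auto simp: append_letter_def colored_perms_def)
      then show "w \<in> {w \<in> colored_perms k (n + 1). last_rank (n + 1) w = r}"
        using last_rank_append_letter[OF v] w by simp
    next
      fix w assume w: "w \<in> {w \<in> colored_perms k (n + 1). last_rank (n + 1) w = r}"
      obtain \<pi> \<xi> where w_eq: "w = (\<pi>, \<xi>)" by fastforce
      have \<pi>: "\<pi> permutes {1..n + 1}" using w by (simp add: w_eq colored_perms_def)
      have last: "\<pi> (n + 1) \<in> {1..n + 1}" using permutes_in_image[OF \<pi>, of "n + 1"] by simp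
      have rank: "r = \<xi> (n + 1) * (n + 1) + (n + 1 - \<pi> (n + 1))"
        using w by (simp add: w_eq last_rank_def)
      have lt: "n + 1 - \<pi> (n + 1) < n + 1" using last by auto
      have \<xi>_last: "\<xi> (n + 1) = r div (n + 1)" and "n + 1 - \<pi> (n + 1) = r mod (n + 1)"
        unfolding rank using lt by (simp_all del: mult_Suc_right)
      then have \<pi>_last: "\<pi> (n + 1) = p" using last by (auto simp: p_def)
      \<comment> \<open>Undoing the cycle sends the last value \<open>p\<close> back to
        \<open>n + 1\<close>, so the remaining letters are permuted among
        \<open>{1..n}\<close>.\<close>
      define \<sigma> where "\<sigma> = inv (insert_cycle n p) \<circ> \<pi>"
      have "\<sigma> permutes {1..n + 1}"
        unfolding \<sigma>_def by (rule permutes_compose[OF \<pi> permutes_inv[OF cyc]])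
      moreover have "\<sigma> (n + 1) = n + 1"
        using permutes_inverses(2)[OF cyc, of "n + 1"] by (simp add: \<sigma>_def \<pi>_last[simplified] insert_cycle_def)
      moreover have "{1..n + 1} - {1..n} = {n + 1}" by auto
      ultimately have \<sigma>: "\<sigma> permutes {1..n}"
        using permutes_superset[of \<sigma> "{1..n + 1}" "{1..n}"] by (metis singletonD)
      have "insert_cycle n p \<circ> \<sigma> = \<pi>"
        using permutes_inverses(1)[OF cyc] by (simp add: \<sigma>_def fun_eq_iff)
      then have "w = append_letter n r (\<sigma>, \<xi>(n + 1 := 0))"
        using \<xi>_last by (simp add: w_eq append_letter_def p_def fun_eq_iff)
      moreover have "(\<sigma>, \<xi>(n + 1 := 0)) \<in> colored_perms k n"
        using w \<sigma> by (auto simp: w_eq colored_perms_def)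
      ultimately show "w \<in> append_letter n r ` colored_perms k n" by blast
    qed
  qed
qed

section \<open>Change of the statistics under appending\<close>

text \<open>The right-hand side is the descent condition at position \<open>n\<close>. Each color
  occupies a block of \<open>n\<close> consecutive ranks with values descending, so colors are
  compared first; \<open>n = 0\<close> rests on the convention at 0.\<close>

lemma last_rank_less_threshold_iff:
  assumes w: "(\<pi>, \<xi>) \<in> colored_perms k n"
  shows "last_rank n (\<pi>, \<xi>) < threshold n r \<longleftrightarrow>
    \<xi> n < r div (n + 1) \<or> \<xi> n = r div (n + 1) \<and> n + 1 - r mod (n + 1) \<le> \<pi> n"
proof (cases "n = 0")
  case True
  then have "\<pi> 0 = 0" "\<xi> 0 = 0" using w by (auto simp: colored_perms_def)
  with True show ?thesis by (simp add: last_rank_def threshold_def)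
next
  case False
  define d c where "d = r div (n + 1)" and "c = r mod (n + 1)"
  have c: "c \<le> n" unfolding c_def using mod_less_divisor[of "n + 1" r] by linarith
  have \<pi>: "\<pi> n \<in> {1..n}"
    using w False permutes_in_image[of \<pi> "{1..n}" n] by (simp add: colored_perms_def)
  have "\<xi> n * n + (n - \<pi> n) < d * n + c \<longleftrightarrow> \<xi> n < d \<or> \<xi> n = d \<and> n + 1 - c \<le> \<pi> n"
  proof (cases "\<xi> n" d rule: linorder_cases)
    case less
    then have "(\<xi> n + 1) * n \<le> d * n" by (intro mult_le_mono1) simp
    with less \<pi> show ?thesis by (auto simp: algebra_simps)
  next
    case equal
    with c \<pi> show ?thesis by auto
  next
    case greater
    then have "(d + 1) * n \<le> \<xi> n * n" by (intro mult_le_mono1) simp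
    with greater c show ?thesis by (auto simp: algebra_simps)
  qed
  with False show ?thesis by (simp add: last_rank_def threshold_def d_def c_def)
qed

text \<open>The cycle preserves the order of the old values, including the value 0 at position 0, so
  only position \<open>n\<close> can become a new descent.\<close>

lemma Des_append_letter:
  assumes w: "w \<in> colored_perms k n"
  shows "Des (n + 1) (append_letter n r w) = Des n w \<union> (if last_rank n w < threshold n r then {n} else {})"
proof -
  obtain \<pi> \<xi> where w_eq: "w = (\<pi>, \<xi>)" by fastforce
  define p where "p = n + 1 - r mod (n + 1)"
  have \<pi>: "\<pi> permutes {1..n}" using w by (simp add: w_eq colored_perms_def)
  have last: "\<pi> (n + 1) = n + 1" using permutes_not_in[OF \<pi>] by simp
  have app: "append_letter n r (\<pi>, \<xi>) = (insert_cycle n p \<circ> \<pi>, \<xi>(n + 1 := r div (n + 1)))"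
    by (simp add: append_letter_def p_def)
  have "i \<in> Des (n + 1) (append_letter n r w) \<longleftrightarrow> i \<in> Des n w" if "i < n" for i
    using that permutes_le[OF \<pi>, of i] permutes_le[OF \<pi>, of "i + 1"]
    unfolding w_eq app by (simp add: Des_def insert_cycle_less_iff)
  moreover have "n \<in> Des (n + 1) (append_letter n r w) \<longleftrightarrow> last_rank n w < threshold n r"
    using permutes_le[OF \<pi>, of n] last last_rank_less_threshold_iff[OF w[unfolded w_eq], of r, folded p_def]
    unfolding w_eq app
    by (simp add: Des_def insert_cycle_def[of n p "Suc n"] less_insert_cycle_iff)
  moreover have "i < n" if "i \<in> Des n w" for i using that by (auto simp: Des_def w_eq)
  moreover have "i < n \<or> i = n" if "i \<in> Des (n + 1) (append_letter n r w)" for i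
    using that unfolding w_eq app by (auto simp: Des_def)
  ultimately show ?thesis by (auto split: if_splits)
qed

lemma Des_subset: "Des n w \<subseteq> {0..<n}"
  by (auto simp: Des_def)

lemma finite_Des [simp]: "finite (Des n w)"
  using Des_subset finite_subset by blast

lemma des_append_letter:
  assumes "w \<in> colored_perms k n"
  shows "des (n + 1) (append_letter n r w) = des n w + (if last_rank n w < threshold n r then 1 else 0)"
proof -
  have "n \<notin> Des n w" using Des_subset[of n w] by auto
  then show ?thesis unfolding des_def Des_append_letter[OF assms] by simp
qed

text \<open>Each old descent gains 1 in \<open>n - j\<close>, and a new descent at \<open>n\<close>
  has weight 1.\<close>

lemma comaj_append_letter:
  assumes "w \<in> colored_perms k n"
  shows "comaj (n + 1) (append_letter n r w) = comaj n w + des (n + 1) (append_letter n r w)"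
proof -
  have n: "n \<notin> Des n w" using Des_subset[of n w] by auto
  have "(\<Sum>j\<in>Des n w. n + 1 - j) = (\<Sum>j\<in>Des n w. (n - j) + 1)"
    using Des_subset[of n w] by (intro sum.cong) auto
  also have "\<dots> = comaj n w + des n w"
    by (simp only: sum.distrib comaj_def des_def card_eq_sum)
  finally show ?thesis
    unfolding des_append_letter[OF assms] using n
    unfolding comaj_def[of "n + 1"] Des_append_letter[OF assms] by simp
qed

text \<open>The last letter \<open>p\<close> forms inversions exactly with the old values from
  \<open>p\<close> to \<open>n\<close>, which the cycle lifts above it.\<close>

lemma inv_num_insert_cycle:
  assumes \<pi>: "\<pi> permutes {1..n}" and p: "p \<in> {1..n + 1}"
  shows "inv_num (n + 1) (insert_cycle n p \<circ> \<pi>) = inv_num n \<pi> + (n + 1 - p)"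
proof -
  define X where "X = {(i, j). 1 \<le> i \<and> i < j \<and> j \<le> n \<and> \<pi> i > \<pi> j}"
  define Y where "Y = {i \<in> {1..n}. \<pi> i \<in> {p..n}}"
  have last: "\<pi> (n + 1) = n + 1" using permutes_not_in[OF \<pi>] by simp
  have "{(i, j). 1 \<le> i \<and> i < j \<and> j \<le> n + 1 \<and> (insert_cycle n p \<circ> \<pi>) i > (insert_cycle n p \<circ> \<pi>) j}
      = X \<union> Y \<times> {n + 1}" (is "?L = _")
  proof (rule set_eqI, clarify)
    fix i j
    show "(i, j) \<in> ?L \<longleftrightarrow> (i, j) \<in> X \<union> Y \<times> {n + 1}"
    proof (cases "j = n + 1")
      case True
      then show ?thesis
        using last permutes_le[OF \<pi>, of i]
        by (auto simp: X_def Y_def insert_cycle_def[of n p "Suc n"] less_insert_cycle_iff)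
    next
      case False
      then show ?thesis
        using permutes_le[OF \<pi>, of i] permutes_le[OF \<pi>, of j]
        by (auto simp: X_def insert_cycle_less_iff)
    qed
  qed
  moreover have "X \<subseteq> {1..n} \<times> {1..n}" by (auto simp: X_def)
  then have "finite X" by (rule finite_subset) simp
  moreover have "finite Y" by (simp add: Y_def)
  moreover have "X \<inter> Y \<times> {n + 1} = {}" by (auto simp: X_def)
  moreover have "card Y = n + 1 - p"
  proof -
    have "\<pi> ` Y = {p..n}"
    proof (intro equalityI subsetI)
      fix y assume y: "y \<in> {p..n}"
      then have "y \<in> \<pi> ` {1..n}" using p permutes_image[OF \<pi>] by auto
      then show "y \<in> \<pi> ` Y" using y by (auto simp: Y_def)
    qed (auto simp: Y_def)
    then show ?thesis
      using card_image[of \<pi> Y] permutes_inj_on[OF \<pi>, of Y] by simp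
  qed
  ultimately show ?thesis
    by (simp add: inv_num_def card_Un_disjoint card_cartesian_product flip: One_nat_def) (simp add: X_def)
qed

text \<open>The new color contributes \<open>n + 1\<close> times the quotient of \<open>r\<close>,
  the new inversions its remainder.\<close>

lemma finv_append_letter:
  assumes w: "w \<in> colored_perms k n"
  shows "finv (n + 1) (append_letter n r w) = finv n w + r"
proof -
  obtain \<pi> \<xi> where w_eq: "w = (\<pi>, \<xi>)" by fastforce
  have rm: "r mod (n + 1) \<le> n" using mod_less_divisor[of "n + 1" r] by linarith
  have "(\<Sum>i = 1..n. i * (\<xi>(n + 1 := r div (n + 1))) i) = (\<Sum>i = 1..n. i * \<xi> i)"
    by (rule sum.cong) auto
  then have "(\<Sum>i = 1..n + 1. i * (\<xi>(n + 1 := r div (n + 1))) i)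
      = (\<Sum>i = 1..n. i * \<xi> i) + (n + 1) * (r div (n + 1))"
    by simp
  moreover have "n + 1 - r mod (n + 1) \<in> {1..n + 1}"
    unfolding atLeastAtMost_iff using rm by linarith
  from inv_num_insert_cycle[OF colored_perms_permutes[OF w[unfolded w_eq]] this]
  have "inv_num (n + 1) (insert_cycle n (n + 1 - r mod (n + 1)) \<circ> \<pi>) = inv_num n \<pi> + r mod (n + 1)"
    using rm by simp
  ultimately show ?thesis
    using mult_div_mod_eq[of "n + 1" r] unfolding finv_def append_letter_def w_eq by simp
qed

section \<open>Recursion for the refined polynomials\<close>

definition weight :: "real \<Rightarrow> real \<Rightarrow> nat \<Rightarrow> complex \<Rightarrow> colored_perm \<Rightarrow> complex" where
  "weight p q n z w = of_real (p ^ comaj n w * q ^ finv n w) * z ^ des n w"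

definition refined :: "real \<Rightarrow> real \<Rightarrow> nat \<Rightarrow> nat \<Rightarrow> complex \<Rightarrow> nat \<Rightarrow> complex" where
  "refined p q k n z r = (\<Sum>w\<in>{w \<in> colored_perms k n. last_rank n w = r}. weight p q n z w)"

text \<open>The weak bound also covers \<open>n = 0\<close>, where the rank is 0; otherwise the top
  index contributes an empty sum.\<close>

lemma last_rank_le: "w \<in> colored_perms k n \<Longrightarrow> last_rank n w \<le> k * n"
  using last_rank_less[of w k n]
  by (cases "n = 0") (auto simp: last_rank_def)

lemma sum_by_last_rank:
  fixes f :: "colored_perm \<Rightarrow> complex"
  shows "(\<Sum>w\<in>colored_perms k n. f w)
    = (\<Sum>h\<le>k * n. \<Sum>w\<in>{w \<in> colored_perms k n. last_rank n w = h}. f w)"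
  by (rule sum.group[symmetric]) (auto simp: finite_colored_perms last_rank_le)

text \<open>As \<open>comaj\<close> grows by the new number of descents, every factor
  \<open>z\<close> turns into \<open>p * z\<close>.\<close>

lemma weight_append_letter:
  assumes "w \<in> colored_perms k n"
  shows "weight p q (n + 1) z (append_letter n r w) =
    of_real (q ^ r) * ((if last_rank n w < threshold n r then of_real p * z else 1) * weight p q n (of_real p * z) w)"
  unfolding weight_def comaj_append_letter[OF assms] finv_append_letter[OF assms] des_append_letter[OF assms]
  by (simp add: power_add power_mult_distrib)

lemma refined_Suc:
  assumes "r < k * (n + 1)"
  shows "refined p q k (n + 1) z r = of_real (q ^ r) *
    (\<Sum>h\<le>k * n. (if h < threshold n r then of_real p * z else 1) * refined p q k n (of_real p * z) h)"
proof -
  have "refined p q k (n + 1) z r = (\<Sum>w\<in>colored_perms k n. weight p q (n + 1) z (append_letter n r w))"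
    unfolding refined_def by (rule sum.reindex_bij_betw[OF append_letter_bij_betw[OF assms], symmetric])
  also have "\<dots> = of_real (q ^ r) * (\<Sum>w\<in>colored_perms k n.
      (if last_rank n w < threshold n r then of_real p * z else 1) * weight p q n (of_real p * z) w)"
    by (simp only: weight_append_letter sum_distrib_left cong: sum.cong)
  also have "(\<Sum>w\<in>colored_perms k n.
      (if last_rank n w < threshold n r then of_real p * z else 1) * weight p q n (of_real p * z) w)
    = (\<Sum>h\<le>k * n. (if h < threshold n r then of_real p * z else 1) * refined p q k n (of_real p * z) h)"
    unfolding sum_by_last_rank refined_def sum_distrib_left by (intro sum.cong) auto
  finally show ?thesis .
qed

text \<open>Both claims are needed together: they make the sum at stage \<open>n\<close> nonzero,
  and that sum is the entry of rank 0 at the next stage. The induction varies \<open>z\<close>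
  because the recursion evaluates at \<open>p * z\<close>.\<close>

lemma refined_fan:
  assumes "k \<ge> 1" "p > 0" "q > 0" "Im z > 0"
  shows "fan z (refined p q k n z) \<and> refined p q k n z 0 \<noteq> 0"
  using assms(4)
proof (induction n arbitrary: z)
  case 0
  have c0: "colored_perms k 0 = {(id, \<lambda>_. 0)}" by (auto simp: colored_perms_def)
  have inv: "inv_num 0 \<pi> = 0" for \<pi>
  proof -
    have "{(i, j). 1 \<le> i \<and> i < j \<and> j \<le> 0 \<and> \<pi> i > \<pi> j} = {}" by auto
    then show ?thesis unfolding inv_num_def by (simp only: card.empty)
  qed
  have "refined p q k 0 z r = (if r = 0 then 1 else 0)" for r
  proof -
    have "{w \<in> colored_perms k 0. last_rank 0 w = r} = (if r = 0 then {(id, \<lambda>_. 0)} else {})"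
      by (auto simp: c0 last_rank_def)
    then show ?thesis
      by (simp add: refined_def weight_def comaj_def des_def Des_def finv_def inv case_prod_beta)
  qed
  then show ?case using 0 by (simp add: fan_def)
next
  case (Suc n)
  define y where "y = of_real p * z"
  have y: "Im y > 0" using Suc.prems assms by (simp add: y_def)
  define b where "b r = of_real (q ^ r) *
    (\<Sum>h\<le>k * n. (if h < threshold n r then y else 1) * refined p q k n y h)" for r
  have "fan y b" unfolding b_def
    using y Suc.IH[OF y] threshold_mono assms by (intro fan_step) auto
  \<comment> \<open>Since \<open>y\<close> is a positive multiple of \<open>z\<close>, the two fan
    conditions agree.\<close>
  moreover have "Im (cnj u * (y * v)) = p * Im (cnj u * (z * v))" for u v
    by (simp add: y_def algebra_simps)
  moreover have "0 \<le> p * x \<longleftrightarrow> 0 \<le> x" for x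
    using assms by (simp add: zero_le_mult_iff)
  ultimately have b: "fan z b" unfolding fan_def by metis
  have eq: "refined p q k (Suc n) z r = (if r < k * (n + 1) then b r else 0)" for r
  proof (cases "r < k * (n + 1)")
    case True
    then show ?thesis using refined_Suc[OF True, of p q z] unfolding b_def y_def by simp
  next
    case False
    then have "{w \<in> colored_perms k (Suc n). last_rank (Suc n) w = r} = {}"
      using last_rank_less[of _ k "n + 1"] by auto
    with False show ?thesis unfolding refined_def by (simp only: sum.empty if_False)
  qed
  \<comment> \<open>Replacing the tail by 0 is harmless, as pairings with 0 vanish.\<close>
  have "fan z (refined p q k (Suc n) z)"
    using b unfolding fan_def eq by auto
  \<comment> \<open>With threshold 0 all coefficients are 1, so \<open>b 0\<close> is the plain sum
    at \<open>y\<close>.\<close>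
  moreover have "b 0 \<noteq> 0"
    using fan_sum_nonzero[OF y, of _ "k * n"] Suc.IH[OF y] by (simp add: b_def)
  then have "refined p q k (Suc n) z 0 \<noteq> 0" using assms by (simp add: eq)
  ultimately show ?case by blast
qed

lemma sum_weight_nonzero:
  assumes "k \<ge> 1" "p > 0" "q > 0" "Im z > 0"
  shows "(\<Sum>w\<in>colored_perms k n. weight p q n z w) \<noteq> 0"
  unfolding sum_by_last_rank refined_def[symmetric]
  using refined_fan[OF assms] assms(4) by (intro fan_sum_nonzero) auto

section \<open>Real-rootedness\<close>

lemma poly_map_poly_sum_monom:
  "poly (map_poly complex_of_real (\<Sum>w\<in>A. monom (c w) (d w))) z = (\<Sum>w\<in>A. of_real (c w) * z ^ d w)"
proof (induction A rule: infinite_finite_induct)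
  case (insert x F)
  have "map_poly complex_of_real (a + b) = map_poly of_real a + map_poly of_real b" for a b
    by (rule poly_eqI) (simp add: coeff_map_poly)
  with insert show ?case by (simp add: map_poly_monom poly_monom)
qed auto

text \<open>The coefficients are real, so nonreal roots come in conjugate pairs.\<close>

lemma all_roots_real_if_upper_half_plane:
  assumes "\<And>z. Im z > 0 \<Longrightarrow> poly (map_poly complex_of_real p) z \<noteq> 0"
  shows "all_roots_real p"
  unfolding all_roots_real_def
proof (intro allI impI)
  fix z assume z: "poly (map_poly complex_of_real p) z = 0"
  have "map_poly cnj (map_poly complex_of_real p) = map_poly complex_of_real p"
    by (rule poly_eqI) (simp add: coeff_map_poly)
  then have "poly (map_poly complex_of_real p) (cnj z) = 0"
    using z poly_cnj[of "map_poly complex_of_real p" z] by simp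
  with z assms[of z] assms[of "cnj z"] have "Im z = 0" by force
  then show "z \<in> \<real>" by (simp add: complex_is_Real_iff)
qed

lemma maj_add_comaj: "maj n w + comaj n w = n * des n w"
proof -
  have "maj n w + comaj n w = (\<Sum>j\<in>Des n w. j + (n - j))"
    by (simp only: maj_def comaj_def sum.distrib)
  also have "\<dots> = (\<Sum>j\<in>Des n w. n)"
    using Des_subset[of n w] by (intro sum.cong) auto
  finally show ?thesis by (simp add: des_def)
qed

theorem theorem5p7:
  fixes n k :: nat and q :: real
  assumes "n \<ge> 1" and "k \<ge> 1" and "q > 0"
  shows "all_roots_real (G_finv n k q) \<and> all_roots_real (G_comaj n k q) \<and> all_roots_real (G_maj n k q)"
proof (intro conjI; rule all_roots_real_if_upper_half_plane)
  fix z :: complex assume z: "Im z > 0"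
  \<comment> \<open>Setting one of the two weight parameters to 1 isolates \<open>finv\<close> or
    \<open>comaj\<close>.\<close>
  show "poly (map_poly complex_of_real (G_finv n k q)) z \<noteq> 0"
    using sum_weight_nonzero[of k 1 q z n] assms z
    by (simp add: G_finv_def poly_map_poly_sum_monom weight_def)
  show "poly (map_poly complex_of_real (G_comaj n k q)) z \<noteq> 0"
    using sum_weight_nonzero[of k q 1 z n] assms z
    by (simp add: G_comaj_def poly_map_poly_sum_monom weight_def)
  \<comment> \<open>From \<open>maj = n * des - comaj\<close>, the polynomial for \<open>maj\<close>
    at \<open>z\<close> is the one for \<open>comaj\<close> with parameter \<open>1 / q\<close> at
    \<open>q ^ n * z\<close>, which stays in the upper half plane.\<close>
  have "weight (1 / q) 1 n (of_real (q ^ n) * z) w = of_real (q ^ maj n w) * z ^ des n w" for w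
  proof -
    have "(q ^ n) ^ des n w = q ^ maj n w * q ^ comaj n w"
      by (simp only: maj_add_comaj flip: power_mult power_add)
    then have "(1 / q) ^ comaj n w * (q ^ n) ^ des n w = q ^ maj n w"
      using assms by (simp add: power_divide)
    then show ?thesis
      unfolding weight_def power_mult_distrib
      by (simp add: mult.assoc[symmetric] flip: of_real_power of_real_mult)
  qed
  then show "poly (map_poly complex_of_real (G_maj n k q)) z \<noteq> 0"
    using sum_weight_nonzero[of k "1 / q" 1 "of_real (q ^ n) * z" n] assms z
    by (simp add: G_maj_def poly_map_poly_sum_monom)
qed

end
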